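(* Let $\mathcal{X}$, $(y_j)_{j=1}^J$, $q$, $(x_n)_{n\in\mathbb{N}}$, $\beta$, $\varphi$, $\hat\varphi$, $B$, $W$, $k_W$ be as in the context, and let $\hat k:\mathcal{X}^2\to\mathbb{R}$, $\hat k(x,y):=k_W(B\circ\hat\varphi(x),B\circ\hat\varphi(y))$. Then for all $x,y\in\mathcal{X}$: (i) if $k_W$ is a Taylor kernel with function $K(t)=\sum_{n\ge0}a_nt^n$, then $$\hat k(x,y)=K\left(\langle\hat\varphi(x),\hat\varphi(y)\rangle_{\mathbb{R}^J}\right)=\sum_{n=0}^{+\infty}a_n\left(\frac1J\sum_{j=1}^J d_{\mathcal{X}}(x,y_j)\,d_{\mathcal{X}}(y,y_j)\right)^n;$$ (ii) if $k_W$ is a radial kernel with function $K(t)=\int_0^{+\infty}e^{-st}\,\mathrm{d}\mu(s)$, then $$\hat k(x,y)=K\left(\|\hat\varphi(x)-\hat\varphi(y)\|_{\mathbb{R}^J}^2\right)=\int_0^{+\infty}\exp\left(-\frac sJ\sum_{j=1}^J\left(d_{\mathcal{X}}(x,y_j)-d_{\mathcal{X}}(y,y_j)\right)^2\right)\mathrm{d}\mu(s).$$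
   Context: Notation: $\mathbb{N}$ includes $0$; $\ell^2$ is the Hilbert space of real square-summable sequences indexed by $\mathbb{N}$; $\mathbb{R}^J$ carries the Euclidean inner product and norm. Space and covering: $(\mathcal{X},d_{\mathcal{X}})$ is a non-empty compact metric space with diameter $D_{\mathcal{X}}>0$; $\eta\in(0,D_{\mathcal{X}}]$; $(y_j)_{j=1}^J$, $J\ge2$, are distinct points of $\mathcal{X}$ such that the closed balls of radius $\eta$ centred at the $y_j$ cover $\mathcal{X}$. Adapted basis: $q\in\left(1,\sqrt{1+\frac1{J-1}}\right)$; $(x_n)_{n\in\mathbb{N}}$ is a basis of $\mathcal{X}$ (a sequence of points of $\mathcal{X}$ such that every $x\in\mathcal{X}$ is within distance $\varepsilon$ of some $x_n$, for every $\varepsilon>0$) and $\beta:\mathbb{N}\to\{1,\dots,J\}$ is a map such that each $\beta^{-1}(\{j\})$ is infinite, $d_{\mathcal{X}}(x_n,y_{\beta(n)})=\min_j d_{\mathcal{X}}(x_n,y_j)$ for all $n$, and $\sum_{n\in\beta^{-1}(\{j\})}q^{-2n}=\frac1J\frac{q^2}{q^2-1}$ for all $j$. Maps: $\varphi:\mathcal{X}\to\ell^2$, $\varphi(x)=\left(c_\varphi d_{\mathcal{X}}(x,x_n)/q^n\right)_{n\in\mathbb{N}}$ with $c_\varphi=\sqrt{q^2-1}/q$; $\hat\varphi:\mathcal{X}\to\mathbb{R}^J$, $\hat\varphi(x)=\left(d_{\mathcal{X}}(x,y_j)/\sqrt J\right)_{j=1}^J$; $B:\mathbb{R}^J\to\ell^2$,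 $B(u)=\left(c_B u_{\beta(n)}/q^n\right)_{n\in\mathbb{N}}$ with $c_B=\sqrt{J(q^2-1)}/q$. Let $W:=\varphi(\mathcal{X})\cup B(\hat\varphi(\mathcal{X}))$, a compact subset of $\ell^2$ with diameter $D_W>0$. Kernel on $W$: $k_W:W^2\to\mathbb{R}$ is one of the following. - Taylor kernel: $k_W(u,v)=K(\langle u,v\rangle_{\ell^2})$ with $K(t)=\sum_{n\ge0}a_nt^n$, all $a_n>0$, where the series converges absolutely on $[-D_W^2,D_W^2]$. - Radial kernel: $k_W(u,v)=K(\|u-v\|_{\ell^2}^2)$ with $K(t)=\int_0^{+\infty}e^{-st}\,\mathrm{d}\mu(s)$ for $t\ge0$, where $\mu$ is a finite Borel measure on $[0,+\infty)$ with $\mathrm{supp}(\mu)\neq\{0\}$. *)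

theory Defs
  imports "HOL-Analysis.Analysis"
begin

section \<open>The space of real square-summable sequences\<close>

typedef ell2 = "{f :: nat \<Rightarrow> real. summable (\<lambda>n. (f n)\<^sup>2)}"
  morphisms coord Abs_ell2
  by (rule exI[of _ "\<lambda>_. 0"]) simp

setup_lifting type_definition_ell2

lemma summable_coord_square: "summable (\<lambda>n. (coord u n)\<^sup>2)"
  using coord[of u] by simp

lemma square_summable_mult:
  fixes f g :: "nat \<Rightarrow> real"
  assumes "summable (\<lambda>n. (f n)\<^sup>2)" and "summable (\<lambda>n. (g n)\<^sup>2)"
  shows "summable (\<lambda>n. f n * g n)"
proof (rule summable_comparison_test')
  show "summable (\<lambda>n. (f n)\<^sup>2 + (g n)\<^sup>2)"
    using assms by (rule summable_add)
  show "norm (f n * g n) \<le> (f n)\<^sup>2 + (g n)\<^sup>2" if "n \<ge> 0" for n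
  proof -
    have "0 \<le> (\<bar>f n\<bar> - \<bar>g n\<bar>)\<^sup>2" by simp
    then have "2 * (\<bar>f n\<bar> * \<bar>g n\<bar>) \<le> (f n)\<^sup>2 + (g n)\<^sup>2"
      by (simp add: power2_diff)
    moreover have "0 \<le> \<bar>f n\<bar> * \<bar>g n\<bar>" by simp
    ultimately show ?thesis unfolding real_norm_def abs_mult by linarith
  qed
qed

lemma summable_coord_mult: "summable (\<lambda>n. coord u n * coord v n)"
  by (rule square_summable_mult) (rule summable_coord_square)+

instantiation ell2 :: real_vector
begin

lift_definition zero_ell2 :: ell2 is "\<lambda>_. 0" by simp

lift_definition plus_ell2 :: "ell2 \<Rightarrow> ell2 \<Rightarrow> ell2" is "\<lambda>f g n. f n + g n"
proof -
  fix f g :: "nat \<Rightarrow> real"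
  assume f: "summable (\<lambda>n. (f n)\<^sup>2)" and g: "summable (\<lambda>n. (g n)\<^sup>2)"
  have "summable (\<lambda>n. (f n)\<^sup>2 + (g n)\<^sup>2 + 2 * (f n * g n))"
    by (intro summable_add summable_mult square_summable_mult f g)
  then show "summable (\<lambda>n. (f n + g n)\<^sup>2)"
    by (simp add: power2_sum mult.assoc)
qed

lift_definition uminus_ell2 :: "ell2 \<Rightarrow> ell2" is "\<lambda>f n. - f n" by simp

definition minus_ell2 :: "ell2 \<Rightarrow> ell2 \<Rightarrow> ell2" where "minus_ell2 u v = u + - v"

lift_definition scaleR_ell2 :: "real \<Rightarrow> ell2 \<Rightarrow> ell2" is "\<lambda>c f n. c * f n"
  by (simp add: power_mult_distrib)

instance
proof
  fix u v w :: ell2 and b c :: real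
  show "u + v + w = u + (v + w)" by transfer (simp add: add.assoc)
  show "u + v = v + u" by transfer (simp add: add.commute)
  show "0 + u = u" by transfer simp
  show "- u + u = 0" by transfer simp
  show "u - v = u + - v" by (rule minus_ell2_def)
  show "c *\<^sub>R (u + v) = c *\<^sub>R u + c *\<^sub>R v" by transfer (simp add: distrib_left)
  show "(b + c) *\<^sub>R u = b *\<^sub>R u + c *\<^sub>R u" by transfer (simp add: distrib_right)
  show "b *\<^sub>R c *\<^sub>R u = (b * c) *\<^sub>R u" by transfer (simp add: mult.assoc)
  show "1 *\<^sub>R u = u" by transfer simp
qed

end

lemma coord_zero [simp]: "coord 0 n = 0" by transfer simp
lemma coord_add [simp]: "coord (u + v) n = coord u n + coord v n" by transfer simp
lemma coord_minus [simp]: "coord (- u) n = - coord u n" by transfer simp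
lemma coord_diff [simp]: "coord (u - v) n = coord u n - coord v n"
  by (simp only: minus_ell2_def coord_add coord_minus diff_conv_add_uminus)
lemma coord_scaleR [simp]: "coord (c *\<^sub>R u) n = c * coord u n" by transfer simp

lemma ell2_eqI: "(\<And>n. coord u n = coord v n) \<Longrightarrow> u = v"
  by (rule coord_inject[THEN iffD1], rule ext)

instantiation ell2 :: real_inner
begin

definition inner_ell2 :: "ell2 \<Rightarrow> ell2 \<Rightarrow> real" where
  "inner_ell2 u v = (\<Sum>n. coord u n * coord v n)"

definition norm_ell2 :: "ell2 \<Rightarrow> real" where "norm_ell2 u = sqrt (inner u u)"

definition dist_ell2 :: "ell2 \<Rightarrow> ell2 \<Rightarrow> real" where "dist_ell2 u v = norm (u - v)"

definition sgn_ell2 :: "ell2 \<Rightarrow> ell2" where "sgn_ell2 u = u /\<^sub>R norm u"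

definition uniformity_ell2 :: "(ell2 \<times> ell2) filter" where
  "uniformity_ell2 = (INF e\<in>{0<..}. principal {(u, v). dist u v < e})"

definition open_ell2 :: "ell2 set \<Rightarrow> bool" where
  "open_ell2 U \<longleftrightarrow> (\<forall>u\<in>U. \<forall>\<^sub>F (u', v) in uniformity. u' = u \<longrightarrow> v \<in> U)"

instance
proof
  fix u v w :: ell2 and c :: real
  show "inner u v = inner v u"
    by (simp add: inner_ell2_def mult.commute)
  show "inner (u + v) w = inner u w + inner v w"
    by (simp add: inner_ell2_def distrib_right suminf_add summable_coord_mult)
  show "inner (c *\<^sub>R u) v = c * inner u v"
    by (simp add: inner_ell2_def mult.assoc suminf_mult summable_coord_mult)
  show "0 \<le> inner u u"
    by (simp add: inner_ell2_def suminf_nonneg summable_coord_mult)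
  show "inner u u = 0 \<longleftrightarrow> u = 0"
  proof
    assume "inner u u = 0"
    then have "\<forall>n. coord u n * coord u n = 0"
      unfolding inner_ell2_def
      by (subst (asm) suminf_eq_zero_iff) (auto intro: summable_coord_mult)
    then show "u = 0" by (intro ell2_eqI) simp
  qed (simp add: inner_ell2_def)
qed (fact norm_ell2_def dist_ell2_def sgn_ell2_def uniformity_ell2_def open_ell2_def)+

end


section \<open>Feature maps\<close>

definition c_phi :: "real \<Rightarrow> real" where
  "c_phi q = sqrt (q\<^sup>2 - 1) / q"

definition phi :: "real \<Rightarrow> (nat \<Rightarrow> 'a::metric_space) \<Rightarrow> 'a \<Rightarrow> ell2" where
  "phi q x p = Abs_ell2 (\<lambda>n. c_phi q * dist p (x n) / q ^ n)"

definition phi_hat :: "('j::finite \<Rightarrow> 'a::metric_space) \<Rightarrow> 'a \<Rightarrow> real ^ 'j" where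
  "phi_hat y p = (\<chi> j. dist p (y j) / sqrt (real CARD('j)))"

definition c_B :: "'j::finite itself \<Rightarrow> real \<Rightarrow> real" where
  "c_B _ q = sqrt (real CARD('j) * (q\<^sup>2 - 1)) / q"

definition B_map :: "real \<Rightarrow> (nat \<Rightarrow> 'j::finite) \<Rightarrow> real ^ 'j \<Rightarrow> ell2" where
  "B_map q \<beta> u = Abs_ell2 (\<lambda>n. c_B TYPE('j) q * (u $ \<beta> n) / q ^ n)"

text \<open>For \<^term>\<open>q > 1\<close> the sequences passed to \<^const>\<open>Abs_ell2\<close> above are indeed
  square-summable, as soon as the points \<^term>\<open>x n\<close> form a bounded set.\<close>

lemma summable_bounded_weighted:
  fixes f :: "nat \<Rightarrow> real"
  assumes "q > 1" and bound: "\<And>n. \<bar>f n\<bar> \<le> M"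
  shows "summable (\<lambda>n. (c * f n / q ^ n)\<^sup>2)"
proof (rule summable_comparison_test')
  have "1 < q\<^sup>2" using assms(1) by (simp add: one_less_power)
  then show "summable (\<lambda>n. (c * M)\<^sup>2 * (1 / q\<^sup>2) ^ n)"
    using assms(1) by (intro summable_mult summable_geometric) simp
  show "norm ((c * f n / q ^ n)\<^sup>2) \<le> (c * M)\<^sup>2 * (1 / q\<^sup>2) ^ n" if "n \<ge> 0" for n
  proof -
    have "(f n)\<^sup>2 \<le> M\<^sup>2" using bound[of n] by (simp add: abs_le_square_iff[symmetric])
    then have "(c * f n)\<^sup>2 / (q ^ n)\<^sup>2 \<le> (c * M)\<^sup>2 / (q ^ n)\<^sup>2"
      by (intro divide_right_mono) (auto simp: power_mult_distrib intro: mult_left_mono)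
    then show ?thesis
      using assms(1) by (simp add: power_divide power_mult[symmetric] mult.commute)
  qed
qed

lemma coord_phi:
  assumes "q > 1" and "bounded (range x)"
  shows "coord (phi q x p) n = c_phi q * dist p (x n) / q ^ n"
proof -
  obtain M where "\<And>n. dist p (x n) \<le> M"
    using assms(2) by (auto simp: bounded_any_center[of _ p])
  then have "summable (\<lambda>n. (c_phi q * dist p (x n) / q ^ n)\<^sup>2)"
    using assms(1) by (intro summable_bounded_weighted[where M = M]) auto
  then show ?thesis
    unfolding phi_def by (subst Abs_ell2_inverse) auto
qed

lemma coord_B_map:
  fixes \<beta> :: "nat \<Rightarrow> 'j::finite"
  assumes "q > 1"
  shows "coord (B_map q \<beta> u) n = c_B TYPE('j) q * (u $ \<beta> n) / q ^ n"
proof -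
  have "summable (\<lambda>n. (c_B TYPE('j) q * (u $ \<beta> n) / q ^ n)\<^sup>2)"
    using assms by (intro summable_bounded_weighted[where M = "norm u"] component_le_norm_cart)
  then show ?thesis
    unfolding B_map_def by (subst Abs_ell2_inverse) auto
qed

definition W_set ::
  "'a::metric_space set \<Rightarrow> ('j::finite \<Rightarrow> 'a) \<Rightarrow> real \<Rightarrow> (nat \<Rightarrow> 'a) \<Rightarrow> (nat \<Rightarrow> 'j) \<Rightarrow> ell2 set"
where
  "W_set X y q x \<beta> = phi q x ` X \<union> B_map q \<beta> ` phi_hat y ` X"


section \<open>Adapted bases\<close>

definition is_basis :: "'a::metric_space set \<Rightarrow> (nat \<Rightarrow> 'a) \<Rightarrow> bool" where
  "is_basis X x \<longleftrightarrow>
     (\<forall>n. x n \<in> X) \<and> (\<forall>p\<in>X. \<forall>\<epsilon>>0. \<exists>n. dist p (x n) \<le> \<epsilon>)"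

definition is_adapted_basis ::
  "'a::metric_space set \<Rightarrow> ('j::finite \<Rightarrow> 'a) \<Rightarrow> real \<Rightarrow> (nat \<Rightarrow> 'a) \<Rightarrow> (nat \<Rightarrow> 'j) \<Rightarrow> bool"
where
  "is_adapted_basis X y q x \<beta> \<longleftrightarrow>
     is_basis X x \<and>
     (\<forall>j. infinite (\<beta> -` {j})) \<and>
     (\<forall>n. dist (x n) (y (\<beta> n)) = (MIN j. dist (x n) (y j))) \<and>
     (\<forall>j. ((\<lambda>n. 1 / q ^ (2 * n)) has_sum
             (1 / real CARD('j) * (q\<^sup>2 / (q\<^sup>2 - 1)))) (\<beta> -` {j}))"


section \<open>Kernels\<close>

text \<open>A kernel \<^term>\<open>k\<close> on \<^term>\<open>W\<close> is represented by a function on the whole space that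
  is only constrained on \<^term>\<open>W \<times> W\<close>. Where the power series of a Taylor kernel
  converges, \<^const>\<open>suminf\<close> is its sum; convergence is required on the interval
  given by the diameter of \<^term>\<open>W\<close>.\<close>

definition taylor_kernel ::
  "ell2 set \<Rightarrow> (nat \<Rightarrow> real) \<Rightarrow> (real \<Rightarrow> real) \<Rightarrow> (ell2 \<Rightarrow> ell2 \<Rightarrow> real) \<Rightarrow> bool"
where
  "taylor_kernel W a K k \<longleftrightarrow>
     (\<forall>n. a n > 0) \<and>
     (\<forall>t\<in>{- (diameter W)\<^sup>2 .. (diameter W)\<^sup>2}. summable (\<lambda>n. \<bar>a n * t ^ n\<bar>)) \<and>
     (\<forall>t. K t = (\<Sum>n. a n * t ^ n)) \<and>
     (\<forall>u\<in>W. \<forall>v\<in>W. k u v = K (inner u v))"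

definition measure_support :: "'a::topological_space measure \<Rightarrow> 'a set" where
  "measure_support M =
     {s \<in> space M. \<forall>U. open U \<longrightarrow> s \<in> U \<longrightarrow> emeasure M (U \<inter> space M) > 0}"

text \<open>The measure of a radial kernel lives on the half-line, so that integrals with
  respect to it run over the nonnegative reals.\<close>

definition radial_kernel ::
  "ell2 set \<Rightarrow> real measure \<Rightarrow> (real \<Rightarrow> real) \<Rightarrow> (ell2 \<Rightarrow> ell2 \<Rightarrow> real) \<Rightarrow> bool"
where
  "radial_kernel W \<mu> K k \<longleftrightarrow>
     sets \<mu> = sets (restrict_space borel {0..}) \<and> finite_measure \<mu> \<and>
     measure_support \<mu> \<noteq> {0} \<and>
     (\<forall>t\<ge>0. K t = (\<integral>s. exp (- s * t) \<partial>\<mu>)) \<and>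
     (\<forall>u\<in>W. \<forall>v\<in>W. k u v = K ((norm (u - v))\<^sup>2))"

definition k_hat ::
  "(ell2 \<Rightarrow> ell2 \<Rightarrow> real) \<Rightarrow> ('j::finite \<Rightarrow> 'a::metric_space) \<Rightarrow> real \<Rightarrow> (nat \<Rightarrow> 'j)
     \<Rightarrow> 'a \<Rightarrow> 'a \<Rightarrow> real"
where
  "k_hat k y q \<beta> p p' = k (B_map q \<beta> (phi_hat y p)) (B_map q \<beta> (phi_hat y p'))"

end

theory Submission
  imports Defs
begin

text \<open>The normalisation of the weights \<open>q\<^bsup>-2n\<^esup>\<close> on each fibre of \<open>\<beta>\<close> makes \<open>B\<close> a linear
  isometry of \<open>\<real>\<^sup>J\<close> into \<open>\<ell>\<^sup>2\<close>, so both inner products and distances of the points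
  \<open>B (phi_hat p)\<close> can be computed in \<open>\<real>\<^sup>J\<close>.\<close>

lemma inner_B_map:
  fixes \<beta> :: "nat \<Rightarrow> 'j::finite"
  assumes q: "1 < q"
    and fibre: "\<And>j. ((\<lambda>n. 1 / q ^ (2 * n)) has_sum
                  (1 / real CARD('j) * (q\<^sup>2 / (q\<^sup>2 - 1)))) (\<beta> -` {j})"
  shows "inner (B_map q \<beta> u) (B_map q \<beta> v) = inner u v"
proof -
  define c where "c = c_B TYPE('j) q"
  define s where "s = 1 / real CARD('j) * (q\<^sup>2 / (q\<^sup>2 - 1))"
  have "1 < q\<^sup>2" using q by (simp add: one_less_power)
  then have q2: "q\<^sup>2 \<noteq> 1" by linarith
  \<comment> \<open>The constant \<open>c_B\<close> is chosen for this: its square J(q^2-1)/q^2 is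
    the reciprocal of the common total weight \<open>s\<close> of the fibres.\<close>
  have cs: "c\<^sup>2 * s = 1"
    using q q2 by (simp add: c_def s_def c_B_def power_divide)
  \<comment> \<open>Extending the weights of a fibre by zero turns its unordered sum into an
    ordinary series over all n, so that the J series can be added termwise.\<close>
  have "(\<lambda>n. if \<beta> n = j then 1 / q ^ (2 * n) else 0) sums s" for j
  proof (rule has_sum_imp_sums)
    show "((\<lambda>n. if \<beta> n = j then 1 / q ^ (2 * n) else 0) has_sum s) UNIV"
      using fibre[of j, folded s_def] by (subst has_sum_cong_neutral) auto
  qed
  then have "(\<lambda>n. \<Sum>j\<in>UNIV. c\<^sup>2 * (u $ j * v $ j) * (if \<beta> n = j then 1 / q ^ (2 * n) else 0))
      sums (\<Sum>j\<in>UNIV. c\<^sup>2 * (u $ j * v $ j) * s)"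
    by (intro sums_sum sums_mult)
  also have "(\<Sum>j\<in>UNIV. c\<^sup>2 * (u $ j * v $ j) * s) = inner u v"
    by (simp add: inner_vec_def mult.commute[of _ s] mult.assoc[symmetric])
       (simp add: cs mult.commute[of s])
  \<comment> \<open>The fibres partition the indices: for each n only the summand with j =
    \<open>\<beta> n\<close> survives, and it is the product of the two n-th coordinates.\<close>
  also have "(\<lambda>n. \<Sum>j\<in>UNIV. c\<^sup>2 * (u $ j * v $ j) * (if \<beta> n = j then 1 / q ^ (2 * n) else 0))
      = (\<lambda>n. coord (B_map q \<beta> u) n * coord (B_map q \<beta> v) n)"
    by (rule ext)
       (simp add: if_distrib[of "\<lambda>t. _ * t"] coord_B_map[OF q] c_def power2_eq_square
         mult_2_right power_add mult_ac cong: if_cong)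
  finally show ?thesis
    unfolding inner_ell2_def by (rule sums_unique[symmetric])
qed

text \<open>Additivity holds coordinatewise; it carries the isometry from inner products over to
  distances.\<close>

lemma B_map_diff:
  assumes "1 < q"
  shows "B_map q \<beta> (u - v) = B_map q \<beta> u - B_map q \<beta> v"
  by (rule ell2_eqI) (simp add: coord_B_map[OF assms] right_diff_distrib diff_divide_distrib)

text \<open>The two factors 1/sqrt(J) in \<open>phi_hat\<close> multiply to the averaging factor
  1/J.\<close>

lemma inner_phi_hat:
  fixes y :: "'j::finite \<Rightarrow> 'a::metric_space"
  shows "inner (phi_hat y u) (phi_hat y v)
    = 1 / real CARD('j) * (\<Sum>j\<in>UNIV. dist u (y j) * dist v (y j))"
  by (simp add: inner_vec_def phi_hat_def sum_divide_distrib)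

lemma norm_phi_hat_diff:
  fixes y :: "'j::finite \<Rightarrow> 'a::metric_space"
  shows "(norm (phi_hat y u - phi_hat y v))\<^sup>2
    = 1 / real CARD('j) * (\<Sum>j\<in>UNIV. (dist u (y j) - dist v (y j))\<^sup>2)"
  unfolding power2_norm_eq_inner inner_vec_def
  by (simp add: phi_hat_def sum_divide_distrib diff_divide_distrib[symmetric] power2_eq_square)

theorem corollary11:
  fixes X :: "'a::metric_space set"
    and \<eta> q :: real
    and y :: "'j::finite \<Rightarrow> 'a"
    and x :: "nat \<Rightarrow> 'a"
    and \<beta> :: "nat \<Rightarrow> 'j"
    and k\<^sub>W :: "ell2 \<Rightarrow> ell2 \<Rightarrow> real"
  assumes "compact X" and "X \<noteq> {}" and "diameter X > 0"
    and "0 < \<eta>" and "\<eta> \<le> diameter X"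
    and "CARD('j) \<ge> 2" and "inj y" and "range y \<subseteq> X"
    and "X \<subseteq> (\<Union>j. cball (y j) \<eta>)"
    and "1 < q" and "q < sqrt (1 + 1 / (real CARD('j) - 1))"
    and "is_adapted_basis X y q x \<beta>"
  shows "(\<forall>a K. taylor_kernel (W_set X y q x \<beta>) a K k\<^sub>W \<longrightarrow>
            (\<forall>u\<in>X. \<forall>v\<in>X.
               k_hat k\<^sub>W y q \<beta> u v = K (inner (phi_hat y u) (phi_hat y v)) \<and>
               K (inner (phi_hat y u) (phi_hat y v)) =
                 (\<Sum>n. a n * (1 / real CARD('j) * (\<Sum>j\<in>UNIV. dist u (y j) * dist v (y j))) ^ n)))
       \<and> (\<forall>\<mu> K. radial_kernel (W_set X y q x \<beta>) \<mu> K k\<^sub>W \<longrightarrow>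
            (\<forall>u\<in>X. \<forall>v\<in>X.
               k_hat k\<^sub>W y q \<beta> u v = K ((norm (phi_hat y u - phi_hat y v))\<^sup>2) \<and>
               K ((norm (phi_hat y u - phi_hat y v))\<^sup>2) =
                 (\<integral>s. exp (- (s / real CARD('j)) *
                          (\<Sum>j\<in>UNIV. (dist u (y j) - dist v (y j))\<^sup>2)) \<partial>\<mu>)))"
proof -
  have fibre: "((\<lambda>n. 1 / q ^ (2 * n)) has_sum
      (1 / real CARD('j) * (q\<^sup>2 / (q\<^sup>2 - 1)))) (\<beta> -` {j})" for j
    using assms(12) by (simp add: is_adapted_basis_def)
  note inner_B = inner_B_map[OF \<open>1 < q\<close> fibre]
  have norm_B: "norm (B_map q \<beta> u - B_map q \<beta> v) = norm (u - v)" for u v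
    by (simp add: norm_eq_sqrt_inner inner_B flip: B_map_diff[OF \<open>1 < q\<close>])
  \<comment> \<open>The kernel is tied to \<open>K\<close> only on \<open>W_set\<close>, so the
    embedded points must be placed there.\<close>
  have in_W: "B_map q \<beta> (phi_hat y u) \<in> W_set X y q x \<beta>" if "u \<in> X" for u
    using that by (simp add: W_set_def)
  show ?thesis
  proof (intro conjI allI impI ballI)
    fix a K u v
    assume k: "taylor_kernel (W_set X y q x \<beta>) a K k\<^sub>W" and uv: "u \<in> X" "v \<in> X"
    show "k_hat k\<^sub>W y q \<beta> u v = K (inner (phi_hat y u) (phi_hat y v))"
      using k in_W[OF uv(1)] in_W[OF uv(2)] by (simp add: taylor_kernel_def k_hat_def inner_B)
    show "K (inner (phi_hat y u) (phi_hat y v)) =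
        (\<Sum>n. a n * (1 / real CARD('j) * (\<Sum>j\<in>UNIV. dist u (y j) * dist v (y j))) ^ n)"
      using k unfolding taylor_kernel_def inner_phi_hat by blast
  next
    fix \<mu> K u v
    assume k: "radial_kernel (W_set X y q x \<beta>) \<mu> K k\<^sub>W" and uv: "u \<in> X" "v \<in> X"
    show "k_hat k\<^sub>W y q \<beta> u v = K ((norm (phi_hat y u - phi_hat y v))\<^sup>2)"
      using k in_W[OF uv(1)] in_W[OF uv(2)] by (simp add: radial_kernel_def k_hat_def norm_B)
    \<comment> \<open>The integral formula for \<open>K\<close> is given for nonnegative arguments,
      which a squared norm is.\<close>
    have "K ((norm (phi_hat y u - phi_hat y v))\<^sup>2) =
        (\<integral>s. exp (- s * (norm (phi_hat y u - phi_hat y v))\<^sup>2) \<partial>\<mu>)"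
      using k by (simp add: radial_kernel_def)
    then show "K ((norm (phi_hat y u - phi_hat y v))\<^sup>2) =
        (\<integral>s. exp (- (s / real CARD('j)) *
                 (\<Sum>j\<in>UNIV. (dist u (y j) - dist v (y j))\<^sup>2)) \<partial>\<mu>)"
      \<comment> \<open>What remains is to move the factor 1/J from the sum onto s inside the
        exponential.\<close>
      unfolding norm_phi_hat_diff by simp
  qed
qed

end
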